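(* Let $$M_p^{\rm sgn}=\sum_{j=1}^{N_{\rm c}}Q_j^+(\lambda_j^+)^p-\sum_{\ell=1}^{N_{\rm h}}Q_\ell^-(\lambda_\ell^-)^p,\qquad p\ge0,$$ be the leading signed moments with material phase nodes $\lambda_j^+$ and cavity phase nodes $\lambda_\ell^-$. After merging coincident nodes and deleting any term with zero effective weight, write $$M_p^{\rm sgn}=\sum_{\nu=1}^{N_{\rm s}}\gamma_\nu\xi_\nu^p$$ with effective nodes $\xi_1,\dots,\xi_{N_{\rm s}}$ and signed effective weights $\gamma_1,\dots,\gamma_{N_{\rm s}}$. If $J\ge N_{\rm s}$, the effective nodes are pairwise distinct, and their weights are nonzero, then the Hankel matrix $H_J(M^{\rm sgn})=(M^{\rm sgn}_{r+s})_{r,s=0}^{J-1}$ satisfies $$\operatorname{rank}H_J(M^{\rm sgn})=N_{\rm s}.$$ If all material and cavity phase nodes $\lambda_1^+,\dots,\lambda_{N_{\rm c}}^+,\lambda_1^-,\dots,\lambda_{N_{\rm h}}^-$ are pairwise distinct, then $N_{\rm s}=N_{\rm c}+N_{\rm h}$, and therefore $$N_{\rm h}=\operatorname{rank}H_J(M^{\rm sgn})-N_{\rm c}.$$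
   Context: The scatterer is $D=\big(\bigcup_{j=1}^{N_{\rm c}}G_j\big)\setminus\big(\bigcup_{\ell=1}^{N_{\rm h}}B_\ell\big)\subset\mathbb{R}^2$, where the $G_j$ are separated filled material components and each cavity $B_\ell$ is compactly contained in one of them. With $q^+$ the filled-material contrast, the strengths are $Q_j^+=\int_{G_j}q^+(y)\,dy$ and $Q_\ell^-=\int_{B_\ell}q^+(y)\,dy$. The phase node of a material component or cavity with phase center $(x,y)$ is the complex number $x-\mathrm{i}y$; the nodes are denoted $\lambda_j^+$ for $G_j$ and $\lambda_\ell^-$ for $B_\ell$. Convention: $\lambda^0=1$ for every $\lambda\in\mathbb{C}$. Effective representation: for each distinct value $\xi$ among the material and cavity nodes, its effective weight is the sum of the $Q_j^+$ with $\lambda_j^+=\xi$ minus the sum of the $Q_\ell^-$ with $\lambda_\ell^-=\xi$; the values with nonzero effective weight are $\xi_1,\dots,\xi_{N_{\rm s}}$ and their weights are $\gamma_1,\dots,\gamma_{N_{\rm s}}$.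
   Formalization: The second part (N_s = N_c + N_h and the formula for N_h) additionally assumes that all strengths Q_j^+ and Q_l^- are nonzero; otherwise a zero-strength term is deleted and the claim fails, e.g. N_c = 1, N_h = 0, Q_1^+ = 0 gives N_s = 0. *)

theory Defs
  imports "HOL-Analysis.Analysis" "Jordan_Normal_Form.DL_Rank"
begin

text \<open>
  Components are indexed by \<open>{1..Nc}\<close> and cavities by \<open>{1..Nh}\<close>; values outside these
  ranges are irrelevant.
\<close>

definition compactly_contained :: "'a::topological_space set \<Rightarrow> 'a set \<Rightarrow> bool" where
  "compactly_contained S T \<longleftrightarrow> compact (closure S) \<and> closure S \<subseteq> interior T"

text \<open>
  The sets are only required to be Lebesgue measurable, so that the integrals of the contrast
  make sense; no openness, boundedness or connectedness of the filled components is imposed.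
\<close>

definition cavity_scatterer ::
  "nat \<Rightarrow> (nat \<Rightarrow> (real \<times> real) set) \<Rightarrow> nat \<Rightarrow> (nat \<Rightarrow> (real \<times> real) set) \<Rightarrow> (real \<times> real) set \<Rightarrow> bool"
where
  "cavity_scatterer Nc G Nh B D \<longleftrightarrow>
     D = (\<Union>j\<in>{1..Nc}. G j) - (\<Union>l\<in>{1..Nh}. B l) \<and>
     (\<forall>j\<in>{1..Nc}. G j \<in> sets lebesgue) \<and>
     (\<forall>l\<in>{1..Nh}. B l \<in> sets lebesgue) \<and>
     (\<forall>i\<in>{1..Nc}. \<forall>j\<in>{1..Nc}. i \<noteq> j \<longrightarrow> separatedin euclidean (G i) (G j)) \<and>
     (\<forall>l\<in>{1..Nh}. \<exists>j\<in>{1..Nc}. compactly_contained (B l) (G j))"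

definition strength :: "(real \<times> real \<Rightarrow> complex) \<Rightarrow> (real \<times> real) set \<Rightarrow> complex" where
  "strength q S = (LINT y:S|lebesgue. q y)"

definition phase_node :: "real \<times> real \<Rightarrow> complex" where
  "phase_node c = Complex (fst c) (- snd c)"

text \<open>
  In the following, \<open>Qp, lp\<close> are the strengths and phase nodes of the material components,
  \<open>Qm, lm\<close> those of the cavities.
\<close>

definition signed_moment ::
  "nat \<Rightarrow> (nat \<Rightarrow> complex) \<Rightarrow> (nat \<Rightarrow> complex) \<Rightarrow> nat \<Rightarrow> (nat \<Rightarrow> complex) \<Rightarrow> (nat \<Rightarrow> complex)
    \<Rightarrow> nat \<Rightarrow> complex" where
  "signed_moment Nc Qp lp Nh Qm lm p =
     (\<Sum>j=1..Nc. Qp j * lp j ^ p) - (\<Sum>l=1..Nh. Qm l * lm l ^ p)"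

definition effective_weight ::
  "nat \<Rightarrow> (nat \<Rightarrow> complex) \<Rightarrow> (nat \<Rightarrow> complex) \<Rightarrow> nat \<Rightarrow> (nat \<Rightarrow> complex) \<Rightarrow> (nat \<Rightarrow> complex)
    \<Rightarrow> complex \<Rightarrow> complex" where
  "effective_weight Nc Qp lp Nh Qm lm z =
     (\<Sum>j\<in>{j\<in>{1..Nc}. lp j = z}. Qp j) - (\<Sum>l\<in>{l\<in>{1..Nh}. lm l = z}. Qm l)"

definition effective_nodes ::
  "nat \<Rightarrow> (nat \<Rightarrow> complex) \<Rightarrow> (nat \<Rightarrow> complex) \<Rightarrow> nat \<Rightarrow> (nat \<Rightarrow> complex) \<Rightarrow> (nat \<Rightarrow> complex)
    \<Rightarrow> complex set" where
  "effective_nodes Nc Qp lp Nh Qm lm =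
     {z \<in> lp ` {1..Nc} \<union> lm ` {1..Nh}. effective_weight Nc Qp lp Nh Qm lm z \<noteq> 0}"

text \<open>
  \<open>xi\<close> enumerates the effective nodes without repetition, in any order, and \<open>gam\<close> lists their
  weights; distinctness of the nodes and nonvanishing of the weights are part of this.
\<close>

definition effective_representation ::
  "nat \<Rightarrow> (nat \<Rightarrow> complex) \<Rightarrow> (nat \<Rightarrow> complex) \<Rightarrow> nat \<Rightarrow> (nat \<Rightarrow> complex) \<Rightarrow> (nat \<Rightarrow> complex)
    \<Rightarrow> nat \<Rightarrow> (nat \<Rightarrow> complex) \<Rightarrow> (nat \<Rightarrow> complex) \<Rightarrow> bool" where
  "effective_representation Nc Qp lp Nh Qm lm Ns xi gam \<longleftrightarrow>
     bij_betw xi {1..Ns} (effective_nodes Nc Qp lp Nh Qm lm) \<and>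
     (\<forall>\<nu>\<in>{1..Ns}. gam \<nu> = effective_weight Nc Qp lp Nh Qm lm (xi \<nu>))"

definition nodes_distinct :: "nat \<Rightarrow> (nat \<Rightarrow> complex) \<Rightarrow> nat \<Rightarrow> (nat \<Rightarrow> complex) \<Rightarrow> bool" where
  "nodes_distinct Nc lp Nh lm \<longleftrightarrow>
     inj_on lp {1..Nc} \<and> inj_on lm {1..Nh} \<and> lp ` {1..Nc} \<inter> lm ` {1..Nh} = {}"

definition hankel :: "nat \<Rightarrow> (nat \<Rightarrow> complex) \<Rightarrow> complex Matrix.mat" where
  "hankel J M = Matrix.mat J J (\<lambda>(r, s). M (r + s))"

text \<open>Rank over the complex numbers; the locale parameter is the number of rows.\<close>

definition hankel_rank :: "nat \<Rightarrow> (nat \<Rightarrow> complex) \<Rightarrow> nat" where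
  "hankel_rank J M = vec_space.rank J (hankel J M)"

end

theory Submission
  imports Defs
begin

text \<open>
  A sum of \<open>N\<close> exponentials \<open>M p = (\<Sum>\<nu><N. g \<nu> * x \<nu> ^ p)\<close> makes its Hankel matrix factor as
  \<open>V diag(g) V\<^sup>T\<close>, where \<open>V\<close> is the Vandermonde matrix whose columns are the power vectors
  \<open>(1, x \<nu>, (x \<nu>)\<^sup>2, \<dots>)\<close>. For distinct nodes and at least \<open>N\<close> rows, polynomial interpolation
  carries both halves of the rank computation. Multiplying the transpose of \<open>V\<close> by a coefficient
  vector evaluates the polynomial at the nodes, and interpolation says that every tuple of values
  arises. Together with nonzero weights this makes \<open>diag(g) V\<^sup>T\<close> surjective, so the Hankel matrix
  and \<open>V\<close> have the same column space (\<open>col_space_hankel_eq_vandermonde\<close>). A linear relation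
  between the columns of \<open>V\<close> is a functional \<open>p \<mapsto> (\<Sum>\<nu><N. c \<nu> * p (x \<nu>))\<close> vanishing on all
  polynomials of low degree; testing it on a polynomial that is 1 at one node and 0 at the others
  kills each coefficient (\<open>rank_vandermonde\<close>). Hence the rank is \<open>N\<close>.

  The signed moments are such a sum: grouping the material and cavity terms by the value of their
  node gives the effective weights, and values of weight zero drop out
  (\<open>signed_moment_eq_sum_effective_nodes\<close>). If all nodes are distinct, each group is a single
  component or cavity, whose weight is plus or minus its strength; with nonzero strengths nothing
  is deleted and the effective nodes number \<open>Nc + Nh\<close>.
\<close>

(* The dollar sign indexes vectors of type 'a Matrix.vec from here on. *)
unbundle no vec_syntax

section \<open>Polynomial interpolation\<close>

lemma poly_eq_sum_of_coeff_bound: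
  fixes p :: "'a::comm_ring_1 poly"
  assumes "\<And>k. k \<ge> n \<Longrightarrow> coeff p k = 0"
  shows "poly p z = (\<Sum>i<n. coeff p i * z ^ i)"
proof (cases "p = 0")
  case False
  then have "degree p < n"
    using assms[of "degree p"] by (metis leading_coeff_0_iff not_le)
  then have "(\<Sum>i\<le>degree p. coeff p i * z ^ i) = (\<Sum>i<n. coeff p i * z ^ i)"
    by (intro sum.mono_neutral_left) (auto simp: coeff_eq_0)
  then show ?thesis by (simp add: poly_altdef)
qed auto

text \<open>
  One node is added at a time (Newton): the product of the linear factors of the old nodes vanishes
  there but not at the new one, so a multiple of it corrects the value at the new node alone.
  The degree bound is stated on coefficients so that it forces \<open>p = 0\<close> when there are no nodes.
\<close>

lemma interpolation_poly_exists:
  fixes X :: "'a::field set"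
  assumes "finite X"
  shows "\<exists>p. (\<forall>k\<ge>card X. coeff p k = 0) \<and> (\<forall>y\<in>X. poly p y = f y)"
  using assms
proof induction
  case empty
  show ?case by (rule exI[of _ 0]) auto
next
  case (insert z X)
  then obtain p where p: "\<forall>k\<ge>card X. coeff p k = 0" "\<forall>y\<in>X. poly p y = f y"
    by blast
  define w where "w = (\<Prod>y\<in>X. [:- y, 1:])"
  have deg: "degree w = card X"
    unfolding w_def by (subst degree_prod_eq_sum_degree) auto
  have wz: "poly w z \<noteq> 0" and wX: "\<forall>y\<in>X. poly w y = 0"
    using insert.hyps by (auto simp: w_def poly_prod)
  let ?p = "p + Polynomial.smult ((f z - poly p z) / poly w z) w"
  have "\<forall>k\<ge>card (insert z X). coeff ?p k = 0"
    using p(1) deg insert.hyps by (auto simp: coeff_eq_0)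
  moreover have "\<forall>y\<in>insert z X. poly ?p y = f y"
    using p(2) wz wX by auto
  ultimately show ?case by blast
qed

corollary interpolation_coeffs_exist:
  fixes x f :: "nat \<Rightarrow> 'a::field"
  assumes "inj_on x {..<N}" "N \<le> J"
  obtains c where "\<And>\<nu>. \<nu> < N \<Longrightarrow> (\<Sum>i<J. c i * x \<nu> ^ i) = f \<nu>"
proof -
  obtain p where p: "\<forall>k\<ge>card (x ` {..<N}). coeff p k = 0"
      "\<forall>y\<in>x ` {..<N}. poly p y = f (inv_into {..<N} x y)"
    using interpolation_poly_exists[of "x ` {..<N}" "\<lambda>y. f (inv_into {..<N} x y)"] by auto
  have "(\<Sum>i<J. coeff p i * x \<nu> ^ i) = f \<nu>" if "\<nu> < N" for \<nu>
  proof -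
    have "poly p (x \<nu>) = (\<Sum>i<J. coeff p i * x \<nu> ^ i)"
      using p(1) assms by (intro poly_eq_sum_of_coeff_bound) (simp add: card_image)
    then show ?thesis
      using p(2) that assms(1) by simp
  qed
  then show thesis by (rule that)
qed

section \<open>Rank of Vandermonde and Hankel matrices\<close>

definition vandermonde :: "nat \<Rightarrow> nat \<Rightarrow> (nat \<Rightarrow> 'a::field) \<Rightarrow> 'a Matrix.mat" where
  "vandermonde J N x = Matrix.mat J N (\<lambda>(r, \<nu>). x \<nu> ^ r)"

lemma vandermonde_carrier [simp]: "vandermonde J N x \<in> carrier_mat J N"
  by (simp add: vandermonde_def)

lemma vandermonde_mult_vec_index:
  assumes "r < J" "c \<in> carrier_vec N"
  shows "(vandermonde J N x *\<^sub>v c) $ r = (\<Sum>\<nu><N. c $ \<nu> * x \<nu> ^ r)"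
  using assms by (simp add: vandermonde_def scalar_prod_def lessThan_atLeast0 mult.commute)

text \<open>
  A linear relation between the columns annihilates the values at the nodes of every polynomial of
  degree below \<open>J\<close>; the bound \<open>N \<le> J\<close> leaves room for polynomials that single out one node.
\<close>

lemma rank_vandermonde:
  fixes x :: "nat \<Rightarrow> 'a::field"
  assumes inj: "inj_on x {..<N}" and NJ: "N \<le> J"
  shows "vec_space.rank J (vandermonde J N x) = N"
proof -
  interpret vec_space "TYPE('a)" J .
  let ?V = "vandermonde J N x"
  have dist: "distinct (cols ?V)"
  proof -
    have "col ?V i \<noteq> col ?V j" if "i < N" "j < N" "i \<noteq> j" for i j
    proof
      assume "col ?V i = col ?V j"
      \<comment> \<open>Two distinct columns require at least two rows, and row 1 holds the nodes themselves.\<close>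
      then have "col ?V i $ 1 = col ?V j $ 1" by simp
      then have "x i = x j" using that NJ by (simp add: vandermonde_def)
      then show False using inj that by (auto dest: inj_onD)
    qed
    then show ?thesis
      by (auto simp: distinct_conv_nth vandermonde_def)
  qed
  have "lin_indpt (set (cols ?V))"
  proof
    assume "lin_dep (set (cols ?V))"
    then obtain c where c: "c \<in> carrier_vec N" "c \<noteq> 0\<^sub>v N" "?V *\<^sub>v c = 0\<^sub>v J"
      using lin_depE[OF vandermonde_carrier _ dist] by blast
    have "c $ \<mu> = 0" if \<mu>: "\<mu> < N" for \<mu>
    proof -
      obtain a where a: "\<And>\<nu>. \<nu> < N \<Longrightarrow> (\<Sum>i<J. a i * x \<nu> ^ i) = (if \<nu> = \<mu> then 1 else 0)"
        using interpolation_coeffs_exist[OF inj NJ, of "\<lambda>\<nu>. if \<nu> = \<mu> then 1 else 0"] by blast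
      have "c $ \<mu> = (\<Sum>\<nu><N. c $ \<nu> * (if \<nu> = \<mu> then 1 else 0))"
        using \<mu> by (simp add: if_distrib[of "(*) _"] cong: if_cong)
      also have "\<dots> = (\<Sum>\<nu><N. c $ \<nu> * (\<Sum>i<J. a i * x \<nu> ^ i))"
        using a by (intro sum.cong) auto
      also have "\<dots> = (\<Sum>\<nu><N. \<Sum>i<J. a i * (c $ \<nu> * x \<nu> ^ i))"
        by (simp add: sum_distrib_left mult.left_commute)
      also have "\<dots> = (\<Sum>i<J. a i * (\<Sum>\<nu><N. c $ \<nu> * x \<nu> ^ i))"
        by (subst sum.swap) (simp add: sum_distrib_left)
      also have "\<dots> = (\<Sum>i<J. a i * (?V *\<^sub>v c) $ i)"
        using c(1) by (simp add: vandermonde_mult_vec_index)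
      also have "\<dots> = 0" using c(3) by simp
      finally show ?thesis .
    qed
    then have "c = 0\<^sub>v N" using c(1) by auto
    then show False using c(2) by contradiction
  qed
  then show ?thesis
    by (intro lin_indpt_full_rank[OF vandermonde_carrier dist])
qed

lemma hankel_carrier [simp]: "hankel J M \<in> carrier_mat J J"
  by (simp add: hankel_def)

text \<open>The factorization of the Hankel matrix, in its action on a vector.\<close>

lemma hankel_mult_vec:
  assumes M: "\<And>p. M p = (\<Sum>\<nu><N. g \<nu> * x \<nu> ^ p)" and a: "a \<in> carrier_vec J"
  shows "hankel J M *\<^sub>v a =
    vandermonde J N x *\<^sub>v Matrix.vec N (\<lambda>\<nu>. g \<nu> * (\<Sum>i<J. a $ i * x \<nu> ^ i))"
proof (rule eq_vecI)
  fix r assume "r < dim_vec (vandermonde J N x *\<^sub>v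
    Matrix.vec N (\<lambda>\<nu>. g \<nu> * (\<Sum>i<J. a $ i * x \<nu> ^ i)))"
  then have r: "r < J" by (simp add: vandermonde_def)
  have "(hankel J M *\<^sub>v a) $ r = (\<Sum>i<J. (\<Sum>\<nu><N. g \<nu> * x \<nu> ^ (r + i)) * a $ i)"
    using a r by (simp add: hankel_def scalar_prod_def lessThan_atLeast0 M)
  also have "\<dots> = (\<Sum>i<J. \<Sum>\<nu><N. g \<nu> * (a $ i * x \<nu> ^ i) * x \<nu> ^ r)"
    by (simp add: sum_distrib_right sum_distrib_left power_add mult_ac)
  also have "\<dots> = (\<Sum>\<nu><N. g \<nu> * (\<Sum>i<J. a $ i * x \<nu> ^ i) * x \<nu> ^ r)"
    by (subst sum.swap) (simp add: sum_distrib_left sum_distrib_right)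
  finally show "(hankel J M *\<^sub>v a) $ r = (vandermonde J N x *\<^sub>v
      Matrix.vec N (\<lambda>\<nu>. g \<nu> * (\<Sum>i<J. a $ i * x \<nu> ^ i))) $ r"
    using r by (simp add: vandermonde_mult_vec_index)
qed (simp add: hankel_def vandermonde_def)

text \<open>
  One inclusion is the factorization. For the other, \<open>V c\<close> is the image of the coefficient vector
  of a polynomial with values \<open>c \<nu> / g \<nu>\<close> at the nodes; this is where the weights must not vanish.
\<close>

lemma col_space_hankel_eq_vandermonde:
  fixes x g :: "nat \<Rightarrow> complex"
  assumes M: "\<And>p. M p = (\<Sum>\<nu><N. g \<nu> * x \<nu> ^ p)"
    and inj: "inj_on x {..<N}" and NJ: "N \<le> J" and g: "\<And>\<nu>. \<nu> < N \<Longrightarrow> g \<nu> \<noteq> 0"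
  shows "vec_space.col_space J (hankel J M) = vec_space.col_space J (vandermonde J N x)"
proof -
  interpret vec_space "TYPE(complex)" J .
  let ?H = "hankel J M" and ?V = "vandermonde J N x"
  have H: "col_space ?H = {y \<in> carrier_vec J. \<exists>a\<in>carrier_vec J. ?H *\<^sub>v a = y}"
    using col_space_eq[OF hankel_carrier] by (simp add: hankel_def)
  have V: "col_space ?V = {y \<in> carrier_vec J. \<exists>c\<in>carrier_vec N. ?V *\<^sub>v c = y}"
    using col_space_eq[OF vandermonde_carrier] by (simp add: vandermonde_def)
  have "\<exists>c\<in>carrier_vec N. ?V *\<^sub>v c = ?H *\<^sub>v a" if "a \<in> carrier_vec J" for a
    using hankel_mult_vec[OF M that] by (metis vec_carrier)
  moreover have "\<exists>a\<in>carrier_vec J. ?H *\<^sub>v a = ?V *\<^sub>v c" if c: "c \<in> carrier_vec N" for c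
  proof -
    obtain b where b: "\<And>\<nu>. \<nu> < N \<Longrightarrow> (\<Sum>i<J. b i * x \<nu> ^ i) = c $ \<nu> / g \<nu>"
      using interpolation_coeffs_exist[OF inj NJ, of "\<lambda>\<nu>. c $ \<nu> / g \<nu>"] by blast
    let ?a = "Matrix.vec J b"
    have "Matrix.vec N (\<lambda>\<nu>. g \<nu> * (\<Sum>i<J. ?a $ i * x \<nu> ^ i)) = c"
      using b g c by (intro eq_vecI) auto
    then have "?H *\<^sub>v ?a = ?V *\<^sub>v c"
      using hankel_mult_vec[OF M, of ?a J] by simp
    then show ?thesis by (intro bexI[of _ ?a]) auto
  qed
  ultimately show ?thesis
    unfolding H V by (metis (no_types, lifting))
qed

theorem hankel_rank_exponential_sum:
  assumes "\<And>p. M p = (\<Sum>\<nu><N. g \<nu> * x \<nu> ^ p)"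
    and "inj_on x {..<N}" and "N \<le> J" and "\<And>\<nu>. \<nu> < N \<Longrightarrow> g \<nu> \<noteq> 0"
  shows "hankel_rank J M = N"
proof -
  interpret vec_space "TYPE(complex)" J .
  have "rank (hankel J M) = rank (vandermonde J N x)"
    using col_space_hankel_eq_vandermonde[OF assms] by (simp add: rank_def col_space_def)
  then show ?thesis
    using rank_vandermonde[OF assms(2,3)] by (simp add: hankel_rank_def)
qed

section \<open>Effective nodes of the signed moments\<close>

lemma signed_moment_eq_sum_effective_nodes:
  "signed_moment Nc Qp lp Nh Qm lm p =
    (\<Sum>z\<in>effective_nodes Nc Qp lp Nh Qm lm. effective_weight Nc Qp lp Nh Qm lm z * z ^ p)"
proof -
  let ?U = "lp ` {1..Nc} \<union> lm ` {1..Nh}"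
  have group: "(\<Sum>j\<in>I. Q j * l j ^ p) = (\<Sum>z\<in>?U. (\<Sum>j\<in>{j\<in>I. l j = z}. Q j) * z ^ p)"
    if "finite I" "l ` I \<subseteq> ?U" for I :: "nat set" and Q l
  proof -
    have "(\<Sum>j\<in>I. Q j * l j ^ p) = (\<Sum>z\<in>?U. \<Sum>j\<in>{j\<in>I. l j = z}. Q j * l j ^ p)"
      using that by (intro sum.group[symmetric]) auto
    then show ?thesis by (simp add: sum_distrib_right)
  qed
  have "signed_moment Nc Qp lp Nh Qm lm p =
      (\<Sum>z\<in>?U. effective_weight Nc Qp lp Nh Qm lm z * z ^ p)"
    unfolding signed_moment_def effective_weight_def
    by (subst (1 2) group) (auto simp: sum_subtractf left_diff_distrib)
  also have "\<dots> = (\<Sum>z\<in>effective_nodes Nc Qp lp Nh Qm lm.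
      effective_weight Nc Qp lp Nh Qm lm z * z ^ p)"
    by (intro sum.mono_neutral_right) (auto simp: effective_nodes_def)
  finally show ?thesis .
qed

lemma card_effective_nodes_distinct:
  assumes dist: "nodes_distinct Nc lp Nh lm"
    and Qp: "\<forall>j\<in>{1..Nc}. Qp j \<noteq> 0" and Qm: "\<forall>l\<in>{1..Nh}. Qm l \<noteq> 0"
  shows "card (effective_nodes Nc Qp lp Nh Qm lm) = Nc + Nh"
proof -
  have inj: "inj_on lp {1..Nc}" "inj_on lm {1..Nh}" and disj: "lp ` {1..Nc} \<inter> lm ` {1..Nh} = {}"
    using dist by (auto simp: nodes_distinct_def)
  have "effective_weight Nc Qp lp Nh Qm lm (lp j) = Qp j" if j: "j \<in> {1..Nc}" for j
  proof -
    have "{i \<in> {1..Nc}. lp i = lp j} = {j}" using inj(1) j by (auto dest: inj_onD)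
    moreover have "{l \<in> {1..Nh}. lm l = lp j} = {}" using disj j by blast
    ultimately show ?thesis unfolding effective_weight_def by (simp only:) simp
  qed
  moreover have "effective_weight Nc Qp lp Nh Qm lm (lm l) = - Qm l" if l: "l \<in> {1..Nh}" for l
  proof -
    have "{i \<in> {1..Nh}. lm i = lm l} = {l}" using inj(2) l by (auto dest: inj_onD)
    moreover have "{j \<in> {1..Nc}. lp j = lm l} = {}" using disj l by blast
    ultimately show ?thesis unfolding effective_weight_def by (simp only:) simp
  qed
  ultimately have "effective_nodes Nc Qp lp Nh Qm lm = lp ` {1..Nc} \<union> lm ` {1..Nh}"
    using Qp Qm by (auto simp: effective_nodes_def)
  then show ?thesis
    using inj disj by (simp add: card_Un_disjoint card_image)
qed

theorem theorem2p4:
  fixes Nc Nh Ns J :: nat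
    and D :: "(real \<times> real) set"
    and G B :: "nat \<Rightarrow> (real \<times> real) set"
    and q :: "real \<times> real \<Rightarrow> complex"
    and cp cm :: "nat \<Rightarrow> real \<times> real"
    and Qp Qm lp lm xi gam M :: "nat \<Rightarrow> complex"
  assumes "cavity_scatterer Nc G Nh B D"
    and "\<And>j. j \<in> {1..Nc} \<Longrightarrow> set_integrable lebesgue (G j) q"
    and "\<And>j. j \<in> {1..Nc} \<Longrightarrow> Qp j = strength q (G j)"
    and "\<And>l. l \<in> {1..Nh} \<Longrightarrow> Qm l = strength q (B l)"
    and "\<And>j. j \<in> {1..Nc} \<Longrightarrow> lp j = phase_node (cp j)"
    and "\<And>l. l \<in> {1..Nh} \<Longrightarrow> lm l = phase_node (cm l)"
    and "\<And>p. M p = signed_moment Nc Qp lp Nh Qm lm p"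
    and "effective_representation Nc Qp lp Nh Qm lm Ns xi gam"
  shows "(\<forall>p. M p = (\<Sum>\<nu>=1..Ns. gam \<nu> * xi \<nu> ^ p)) \<and>
    (Ns \<le> J \<and> inj_on xi {1..Ns} \<and> (\<forall>\<nu>\<in>{1..Ns}. gam \<nu> \<noteq> 0) \<longrightarrow>
       hankel_rank J M = Ns) \<and>
    (nodes_distinct Nc lp Nh lm \<and>
       (\<forall>j\<in>{1..Nc}. Qp j \<noteq> 0) \<and> (\<forall>l\<in>{1..Nh}. Qm l \<noteq> 0) \<longrightarrow>
       Ns = Nc + Nh \<and>
       (Ns \<le> J \<longrightarrow> int Nh = int (hankel_rank J M) - int Nc))"
proof -
  let ?E = "effective_nodes Nc Qp lp Nh Qm lm" and ?w = "effective_weight Nc Qp lp Nh Qm lm"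
  have bij: "bij_betw xi {1..Ns} ?E" and gam: "\<And>\<nu>. \<nu> \<in> {1..Ns} \<Longrightarrow> gam \<nu> = ?w (xi \<nu>)"
    using assms(8) by (auto simp: effective_representation_def)
  have gam_nz: "gam \<nu> \<noteq> 0" if "\<nu> \<in> {1..Ns}" for \<nu>
    using bij_betwE[OF bij] gam that by (auto simp: effective_nodes_def)
  have repr: "M p = (\<Sum>\<nu>=1..Ns. gam \<nu> * xi \<nu> ^ p)" for p
  proof -
    have "M p = (\<Sum>z\<in>?E. ?w z * z ^ p)"
      using assms(7) signed_moment_eq_sum_effective_nodes by simp
    also have "\<dots> = (\<Sum>\<nu>=1..Ns. ?w (xi \<nu>) * xi \<nu> ^ p)"
      by (rule sum.reindex_bij_betw[OF bij, symmetric])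
    finally show ?thesis using gam by simp
  qed
  have rank: "hankel_rank J M = Ns" if "Ns \<le> J"
  proof (rule hankel_rank_exponential_sum[OF _ _ that])
    show "M p = (\<Sum>\<nu><Ns. gam (Suc \<nu>) * xi (Suc \<nu>) ^ p)" for p
      using repr[of p] by (simp add: sum.atLeast1_atMost_eq)
    show "inj_on (\<lambda>\<nu>. xi (Suc \<nu>)) {..<Ns}"
      using bij_betw_imp_inj_on[OF bij] by (intro inj_onI) (auto dest: inj_onD)
    show "gam (Suc \<nu>) \<noteq> 0" if "\<nu> < Ns" for \<nu>
      using gam_nz that by simp
  qed
  have count: "Ns = Nc + Nh" if "nodes_distinct Nc lp Nh lm"
    "\<forall>j\<in>{1..Nc}. Qp j \<noteq> 0" "\<forall>l\<in>{1..Nh}. Qm l \<noteq> 0"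
    using card_effective_nodes_distinct[OF that] bij_betw_same_card[OF bij] by simp
  show ?thesis
  proof (intro conjI impI allI)
    show "M p = (\<Sum>\<nu>=1..Ns. gam \<nu> * xi \<nu> ^ p)" for p
      by (rule repr)
    show "hankel_rank J M = Ns"
      if "Ns \<le> J \<and> inj_on xi {1..Ns} \<and> (\<forall>\<nu>\<in>{1..Ns}. gam \<nu> \<noteq> 0)"
      using rank that by blast
    assume *: "nodes_distinct Nc lp Nh lm \<and> (\<forall>j\<in>{1..Nc}. Qp j \<noteq> 0) \<and> (\<forall>l\<in>{1..Nh}. Qm l \<noteq> 0)"
    show "Ns = Nc + Nh"
      using count * by blast
    then show "int Nh = int (hankel_rank J M) - int Nc" if "Ns \<le> J"
      using rank[OF that] by linarith
  qed
qed

end
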